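(* Let $c>0$ with $c^2\neq 1$, and let $v$ be a kink wave solution of speed $c$ of the sine-Gordon equation $u_{tt}=u_{xx}+\sin u$. Then $v$ is spectrally stable; that is, there is no eigenvalue $\lambda\in\mathbb{C}$ with $\operatorname{Re}\lambda>0$ of the linearization of the sine-Gordon equation (in the moving coordinate $z=x+ct$) about $v$.
   Context: In the moving coordinate $z=x+ct$ ($c>0$ the wave speed), the sine-Gordon equation $u_{tt}=u_{xx}+\sin u$ becomes $c^2v_{zz}+2cv_{zt}+v_{tt}=v_{zz}+\sin v$. A travelling wave solution of speed $c$ is a $t$-independent real solution $v(z)$, i.e. a solution on $\mathbb{R}$ of the pendulum equation $(c^2-1)v_{zz}=\sin v$. A kink wave is a travelling wave solution corresponding to a heteroclinic orbit in the $(v,v_z)$ phase plane of the pendulum equation (an orbit joining two distinct equilibria of the form $(k\pi,0)$, $k\in\mathbb{Z}$, where $v$ is not taken modulo $2\pi$). Linearizing about $v$ gives $(c^2-1)\varphi_{zz}+2c\varphi_{zt}+\varphi_{tt}=(\cos v)\varphi$, or, as a first-order system in $t$ with $\psi=\varphi_t$, $(\varphi,\psi)_t=\big(\psi,\ (\cos v)\varphi-(c^2-1)\varphi_{zz}-2c\psi_z\big)$. Eigenvalue: $\lambda\in\mathbb{C}$ is an eigenvalue if there is a twice differentiable function $\varphi:\mathbb{R}\to\mathbb{C}$ in $L^2(\mathbb{R})$, not identically zero, satisfying $$(c^2-1)\varphi_{zz}+2c\lambda\varphi_z+(\lambda^2-\cos v(z))\varphi=0\quad\text{for all } z\in\mathbb{R},\qquad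 \lim_{z\to\pm\infty}\varphi(z)=0.$$ Spectral stability of $v$ means that there are no eigenvalues $\lambda$ (in this sense) with $\operatorname{Re}\lambda>0$. *)

theory Defs
  imports "HOL-Analysis.Analysis"
begin

(* A profile v that does not depend on t solves the sine-Gordon equation
     c^2 v_zz + 2 c v_zt + v_tt = v_zz + sin v
   in the moving coordinate z = x + c t iff it solves the pendulum equation below. *)
definition travelling_wave :: "real \<Rightarrow> (real \<Rightarrow> real) \<Rightarrow> bool" where
  "travelling_wave c v \<longleftrightarrow>
     (\<forall>z. v differentiable (at z)) \<and>
     (\<forall>z. deriv v differentiable (at z)) \<and>
     (\<forall>z. (c\<^sup>2 - 1) * deriv (deriv v) z = sin (v z))"

(* The orbit lives in the plane, not the cylinder: v is not reduced modulo 2 pi, so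
   equilibria (j pi, 0) and (k pi, 0) with j \<noteq> k are distinct. *)
definition kink_wave :: "real \<Rightarrow> (real \<Rightarrow> real) \<Rightarrow> bool" where
  "kink_wave c v \<longleftrightarrow>
     travelling_wave c v \<and>
     (\<exists>j k :: int. j \<noteq> k \<and>
        ((\<lambda>z. (v z, deriv v z)) \<longlongrightarrow> (of_int j * pi, 0)) at_bot \<and>
        ((\<lambda>z. (v z, deriv v z)) \<longlongrightarrow> (of_int k * pi, 0)) at_top)"

definition square_integrable :: "(real \<Rightarrow> complex) \<Rightarrow> bool" where
  "square_integrable \<phi> \<longleftrightarrow>
     \<phi> \<in> borel_measurable lborel \<and> integrable lborel (\<lambda>z. (cmod (\<phi> z))\<^sup>2)"

(* The equation arises from inserting exp (\<mu> t) \<phi>(z) into the linearization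
     (c^2 - 1) \<phi>_zz + 2 c \<phi>_zt + \<phi>_tt = (cos v) \<phi>
   of the sine-Gordon equation about v; \<phi>' and \<phi>'' are the derivatives of \<phi>. *)
definition eigenvalue :: "real \<Rightarrow> (real \<Rightarrow> real) \<Rightarrow> complex \<Rightarrow> bool" where
  "eigenvalue c v \<mu> \<longleftrightarrow>
     (\<exists>\<phi> \<phi>' \<phi>'' :: real \<Rightarrow> complex.
        (\<forall>z. (\<phi> has_vector_derivative \<phi>' z) (at z)) \<and>
        (\<forall>z. (\<phi>' has_vector_derivative \<phi>'' z) (at z)) \<and>
        square_integrable \<phi> \<and>
        (\<exists>z. \<phi> z \<noteq> 0) \<and>
        (\<forall>z. of_real (c\<^sup>2 - 1) * \<phi>'' z + 2 * of_real c * \<mu> * \<phi>' z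
               + (\<mu>\<^sup>2 - of_real (cos (v z))) * \<phi> z = 0) \<and>
        (\<phi> \<longlongrightarrow> 0) at_bot \<and> (\<phi> \<longlongrightarrow> 0) at_top)"

definition spectrally_stable :: "real \<Rightarrow> (real \<Rightarrow> real) \<Rightarrow> bool" where
  "spectrally_stable c v \<longleftrightarrow> \<not> (\<exists>\<mu>. eigenvalue c v \<mu> \<and> Re \<mu> > 0)"

end

theory Submission
  imports Defs "HOL-Real_Asymp.Real_Asymp"
begin

text \<open>
  Write \<open>a = c\<^sup>2 - 1\<close>.  Multiplying an eigenfunction \<open>\<phi>\<close> by \<open>exp (\<rho> z)\<close> with
  \<open>\<rho> = c \<mu> / a\<close> removes the first-order term of the eigenvalue equation and leaves the
  Schroedinger equation \<open>w'' = (cos v / a + \<nu>\<^sup>2) w\<close> with \<open>\<nu> = \<mu> / \<bar>a\<bar>\<close>.  Its potential is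
  reflectionless, so all solutions are known in closed form and an eigenvalue can be excluded
  by reading off their growth at the two ends.
  
  The closed form comes from the translation mode \<open>v'\<close>, a solution at \<open>\<nu> = 0\<close>.
  Conservation of energy shows that \<open>v'\<close> has no zero, and that its logarithmic derivative
  \<open>- T = v'' / v'\<close> satisfies \<open>T' = \<kappa>\<^sup>2 - T\<^sup>2\<close> and \<open>cos v / a = 2 T\<^sup>2 - \<kappa>\<^sup>2\<close> for a constant
  \<open>\<kappa> > 0\<close>.  Hence \<open>T\<close> is a shifted \<open>\<kappa> tanh (\<kappa> z)\<close> (\<open>kink_potential_tanh\<close>), whatever the
  sign of \<open>a\<close>.  With \<open>s\<^sup>2 = \<nu>\<^sup>2 + \<kappa>\<^sup>2\<close> the equation reads
  \<open>w'' = (s\<^sup>2 + 2 T\<^sup>2 - 2 \<kappa>\<^sup>2) w\<close>, which is solved by \<open>exp (s z) (s - T)\<close> and by the same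
  expression with \<open>- s\<close> for \<open>s\<close>.  Their Wronskian is \<open>2 s (s\<^sup>2 - \<kappa>\<^sup>2) = 2 s \<nu>\<^sup>2 \<noteq> 0\<close>, so every
  solution is a combination of the two (\<open>schroedinger_solution_jost\<close>).
  
  Thus \<open>\<phi>\<close> is a combination of exponentials with exponents \<open>s - \<rho>\<close> and \<open>- s - \<rho>\<close>, whose
  amplitudes tend to nonzero limits \<open>\<plusminus> s \<plusminus> \<kappa>\<close> at both ends.  If \<open>Re \<mu> > 0\<close> then \<open>Re s > 0\<close>, so
  the exponents have different real parts.  If the real parts lie on the two sides of \<open>0\<close>
  (possibly with one of them equal to \<open>0\<close>), decay at \<open>\<infinity>\<close> kills one coefficient and decay at
  \<open>- \<infinity>\<close> the other.  If both are positive or both negative, decay at one and the same end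
  kills the two coefficients in turn (\<open>jost_combination_decaying_zero\<close>).  In every case
  \<open>\<phi> = 0\<close>.
\<close>

section \<open>The profile of a kink\<close>

text \<open>
  Gronwall's argument: \<open>y\<^sup>2 exp (- 2 K z)\<close> is nonincreasing and vanishes at \<open>z0\<close>.
\<close>

lemma zero_forward_of_deriv_bound:
  fixes y y' :: "real \<Rightarrow> real"
  assumes D: "\<And>z. (y has_real_derivative y' z) (at z)"
    and bound: "\<And>z. \<bar>y' z\<bar> \<le> K * \<bar>y z\<bar>"
    and zero: "y z0 = 0" and le: "z0 \<le> z"
  shows "y z = 0"
proof -
  define F where "F = (\<lambda>z. (y z)\<^sup>2 * exp (- (2 * K * z)))"
  have DF: "(F has_real_derivative (2 * (y z * y' z) - 2 * K * (y z)\<^sup>2) * exp (- (2 * K * z))) (at z)" for z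
    unfolding F_def by (auto intro!: derivative_eq_intros D simp: algebra_simps)
  have "y z * y' z \<le> K * (y z)\<^sup>2" for z
  proof -
    have "y z * y' z \<le> \<bar>y z\<bar> * \<bar>y' z\<bar>" by (metis abs_ge_self abs_mult)
    also have "\<dots> \<le> \<bar>y z\<bar> * (K * \<bar>y z\<bar>)" by (intro mult_left_mono bound) auto
    finally show ?thesis by (simp add: power2_eq_square algebra_simps)
  qed
  then have "(2 * (y z * y' z) - 2 * K * (y z)\<^sup>2) * exp (- (2 * K * z)) \<le> 0" for z
    by (intro mult_nonpos_nonneg) (auto simp: algebra_simps)
  then have "F z \<le> F z0"
    using DERIV_nonpos_imp_nonincreasing[OF le, of F] DF by blast
  then have "(y z)\<^sup>2 * exp (- (2 * K * z)) \<le> 0" by (simp add: F_def zero)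
  then show ?thesis by (simp add: mult_le_0_iff)
qed

lemma zero_of_deriv_bound:
  fixes y y' :: "real \<Rightarrow> real"
  assumes D: "\<And>z. (y has_real_derivative y' z) (at z)"
    and bound: "\<And>z. \<bar>y' z\<bar> \<le> K * \<bar>y z\<bar>"
    and zero: "y z0 = 0"
  shows "y z = 0"
proof (cases "z0 \<le> z")
  case True
  then show ?thesis using zero_forward_of_deriv_bound[OF D bound zero] by blast
next
  case False
  have D': "((\<lambda>x. y (- x)) has_real_derivative - y' (- x)) (at x)" for x
    by (rule DERIV_cong[OF DERIV_chain'[OF _ D]]) (auto intro!: derivative_eq_intros)
  have "y (- (- z)) = 0"
    by (rule zero_forward_of_deriv_bound[OF D', where K = K and ?z0.0 = "- z0"])
      (use bound zero False in auto)
  then show ?thesis by simp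
qed

text \<open>
  The energy identity, with \<open>\<tau>\<close> the value of \<open>cos v\<close> at the end of the orbit.  It makes \<open>v'\<close>
  nowhere zero: at a zero of \<open>v'\<close>, it forces \<open>sin v = 0\<close>, and \<open>v\<close> would stay at
  this equilibrium by uniqueness, whereas a kink joins two different ones.  Uniqueness is
  obtained from the first-order bound \<open>\<bar>v'\<bar> \<le> K \<bar>v - v z0\<bar>\<close>, again a consequence of the energy
  identity.
\<close>

lemma kink_pendulum:
  assumes "c\<^sup>2 \<noteq> 1" and "kink_wave c v"
  obtains v' \<tau> where
    "\<And>z. (v has_real_derivative v' z) (at z)"
    "\<And>z. (v' has_real_derivative sin (v z) / (c\<^sup>2 - 1)) (at z)"
    "\<tau> = 1 \<or> \<tau> = - 1"
    "\<And>z. (c\<^sup>2 - 1) * (v' z)\<^sup>2 = 2 * (\<tau> - cos (v z))"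
    "\<And>z. v' z \<noteq> 0"
proof -
  define a where "a = c\<^sup>2 - 1"
  have a: "a \<noteq> 0" using assms(1) by (simp add: a_def)
  define v' where "v' = deriv v"
  obtain j k :: int where jk: "j \<noteq> k"
    and bot: "((\<lambda>z. (v z, v' z)) \<longlongrightarrow> (of_int j * pi, 0)) at_bot"
    and top: "((\<lambda>z. (v z, v' z)) \<longlongrightarrow> (of_int k * pi, 0)) at_top"
    using assms(2) unfolding kink_wave_def v'_def by auto
  have tw: "travelling_wave c v" using assms(2) by (simp add: kink_wave_def)
  have D: "(v has_real_derivative v' z) (at z)" for z
    using tw unfolding travelling_wave_def v'_def
    by (metis DERIV_deriv_iff_real_differentiable)
  have D': "(v' has_real_derivative sin (v z) / a) (at z)" for z
  proof -
    have "(v' has_real_derivative deriv v' z) (at z)"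
      using tw unfolding travelling_wave_def v'_def
      by (metis DERIV_deriv_iff_real_differentiable)
    moreover have "a * deriv v' z = sin (v z)"
      using tw unfolding travelling_wave_def v'_def a_def by blast
    moreover from this a have "deriv v' z = sin (v z) / a" by (simp add: eq_divide_eq mult.commute)
    ultimately show ?thesis by simp
  qed
  have vbot: "(v \<longlongrightarrow> of_int j * pi) at_bot" using tendsto_fst[OF bot] by simp
  have vtop: "(v \<longlongrightarrow> of_int k * pi) at_top" using tendsto_fst[OF top] by simp
  have v'top: "(v' \<longlongrightarrow> 0) at_top" using tendsto_snd[OF top] by simp
  define \<tau> where "\<tau> = cos (of_int k * pi)"
  have \<tau>: "\<tau> = 1 \<or> \<tau> = - 1"
    by (metis \<tau>_def mult.commute cos_npi_int)
  define E where "E = (\<lambda>z. a * (v' z)\<^sup>2 / 2 + cos (v z))"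
  have "(E has_real_derivative 0) (at z)" for z
    unfolding E_def using a by (auto intro!: derivative_eq_intros D D' simp: field_simps)
  then have Econst: "E z = E 0" for z by (intro DERIV_isconst_all) auto
  have "(E \<longlongrightarrow> a * 0\<^sup>2 / 2 + cos (of_int k * pi)) at_top"
    unfolding E_def by (intro tendsto_intros v'top vtop) auto
  moreover have "E = (\<lambda>_. E 0)" using Econst by blast
  ultimately have "((\<lambda>_. E 0) \<longlongrightarrow> \<tau>) (at_top :: real filter)"
    by (metis (no_types, lifting) \<tau>_def add_0 div_0 mult_zero_right zero_power2)
  then have "E 0 = \<tau>" by (simp add: tendsto_const_iff)
  then have energy: "a * (v' z)\<^sup>2 = 2 * (\<tau> - cos (v z))" for z
    using Econst[of z] by (simp add: E_def field_simps)
  have nz: "v' z0 \<noteq> 0" for z0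
  proof
    assume 0: "v' z0 = 0"
    define y where "y = (\<lambda>z. v z - v z0)"
    have cos0: "cos (v z0) = \<tau>" using energy[of z0] 0 by simp
    have sin0: "sin (v z0) = 0"
      using sin_cos_squared_add[of "v z0"] \<tau> by (auto simp: cos0)
    have "\<bar>v' z\<bar> \<le> sqrt (1 / \<bar>a\<bar>) * \<bar>y z\<bar>" for z
    proof -
      have "cos (v z) = \<tau> * cos (y z)"
        using cos_add[of "v z0" "y z"] by (simp add: y_def cos0 sin0)
      then have "a * (v' z)\<^sup>2 = \<tau> * (2 * (1 - cos (y z)))"
        using energy[of z] by (simp add: algebra_simps)
      then have "\<bar>a\<bar> * (v' z)\<^sup>2 = \<bar>\<tau>\<bar> * (2 * (1 - cos (y z)))"
        by (metis abs_mult abs_of_nonneg cos_le_one diff_ge_0_iff_ge mult_nonneg_nonneg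
            zero_le_numeral zero_le_power2)
      also have "\<dots> = 2 * (1 - cos (y z))" using \<tau> by auto
      also have "\<dots> \<le> (y z)\<^sup>2"
      proof -
        have "cos (y z) = 1 - 2 * (sin (y z / 2))\<^sup>2" using cos_double_sin[of "y z / 2"] by simp
        moreover have "\<bar>sin (y z / 2)\<bar> \<le> \<bar>y z / 2\<bar>" by (rule abs_sin_x_le_abs_x)
        then have "(sin (y z / 2))\<^sup>2 \<le> (y z / 2)\<^sup>2" by (simp only: abs_le_square_iff)
        ultimately show ?thesis by (simp add: power_divide)
      qed
      finally have "(v' z)\<^sup>2 \<le> 1 / \<bar>a\<bar> * (y z)\<^sup>2" using a by (simp add: field_simps)
      then have "sqrt ((v' z)\<^sup>2) \<le> sqrt (1 / \<bar>a\<bar> * (y z)\<^sup>2)" by (rule real_sqrt_le_mono)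
      then show ?thesis by (simp only: real_sqrt_mult real_sqrt_abs)
    qed
    moreover have "(y has_real_derivative v' z) (at z)" for z
      unfolding y_def by (auto intro!: derivative_eq_intros D)
    moreover have "y z0 = 0" by (simp add: y_def)
    ultimately have "y z = 0" for z
      using zero_of_deriv_bound by blast
    then have "v = (\<lambda>_. v z0)" by (auto simp: y_def)
    then have "v z0 = of_int j * pi" "v z0 = of_int k * pi"
      using vbot vtop by (metis tendsto_const_iff trivial_limit_at_bot_linorder,
        metis tendsto_const_iff trivial_limit_at_top_linorder)
    then show False using jk by simp
  qed
  show thesis by (rule that[OF D _ \<tau> _ nz]) (use D' energy a_def in auto)
qed

lemma tanh_artanh_real:
  fixes x :: real
  assumes "\<bar>x\<bar> < 1"
  shows "tanh (artanh x) = x"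
proof -
  have pos: "0 < 1 + x" "0 < 1 - x" using assms by auto
  have "exp (- 2 * artanh x) = (1 - x) / (1 + x)"
    using pos by (simp add: artanh_def exp_minus)
  then have "tanh (artanh x) = (1 - (1 - x) / (1 + x)) / (1 + (1 - x) / (1 + x))"
    by (simp only: tanh_real_altdef)
  also have "\<dots> = (2 * x / (1 + x)) / (2 / (1 + x))"
    using pos by (intro arg_cong2[where f = "(/)"]) (simp_all add: field_simps)
  also have "\<dots> = x" using pos by simp
  finally show ?thesis .
qed

text \<open>
  The function \<open>T = - v'' / v'\<close> turns the linear equation of the translation mode \<open>v'\<close> into a
  Riccati equation, which the energy identity reduces to \<open>T' = \<kappa>\<^sup>2 - T\<^sup>2\<close> with
  \<open>\<bar>T\<bar> < \<kappa>\<close>; so \<open>artanh (T / \<kappa>)\<close> has slope \<open>\<kappa>\<close>.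
\<close>

lemma kink_potential_tanh:
  assumes "c\<^sup>2 \<noteq> 1" and "kink_wave c v"
  obtains \<kappa> d :: real where "\<kappa> > 0"
    and "\<And>z. cos (v z) / (c\<^sup>2 - 1) = 2 * (\<kappa> * tanh (\<kappa> * z + d))\<^sup>2 - \<kappa>\<^sup>2"
proof -
  obtain v' \<tau> where D: "\<And>z. (v has_real_derivative v' z) (at z)"
    and D': "\<And>z. (v' has_real_derivative sin (v z) / (c\<^sup>2 - 1)) (at z)"
    and \<tau>: "\<tau> = 1 \<or> \<tau> = - 1"
    and energy: "\<And>z. (c\<^sup>2 - 1) * (v' z)\<^sup>2 = 2 * (\<tau> - cos (v z))"
    and nz: "\<And>z. v' z \<noteq> 0"
    using kink_pendulum[OF assms] by metis
  define a where "a = c\<^sup>2 - 1"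
  have a: "a \<noteq> 0" using assms(1) by (simp add: a_def)
  note D' = D'[folded a_def] and energy = energy[folded a_def]
  \<comment> \<open>The sign of \<open>a\<close> decides which equilibria are saddles; only these are joined by an orbit.\<close>
  have "\<tau> / a > 0"
  proof -
    have "(v' 0)\<^sup>2 > 0" using nz by simp
    then show ?thesis
      using energy[of 0] \<tau> a cos_le_one[of "v 0"] cos_ge_minus_one[of "v 0"]
      by (smt (verit) mult_neg_pos mult_pos_pos zero_less_divide_iff)
  qed
  define \<kappa> where "\<kappa> = sqrt (\<tau> / a)"
  have \<kappa>: "\<kappa> > 0" and \<kappa>2: "\<kappa>\<^sup>2 = \<tau> / a"
    using \<open>\<tau> / a > 0\<close> by (auto simp: \<kappa>_def)
  define T where "T = (\<lambda>z. - (sin (v z) / a) / v' z)"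
  have T2: "2 * (T z)\<^sup>2 = (\<tau> + cos (v z)) / a" for z
  proof -
    have "(sin (v z))\<^sup>2 = (\<tau> - cos (v z)) * (\<tau> + cos (v z))"
      using \<tau> by (auto simp: sin_squared_eq algebra_simps power2_eq_square)
    then have "2 * (sin (v z))\<^sup>2 = a * (v' z)\<^sup>2 * (\<tau> + cos (v z))"
      using energy[of z] by simp
    then show ?thesis
      using a nz[of z] by (simp add: T_def power_divide field_simps power2_eq_square)
  qed
  have T'_pos: "\<kappa>\<^sup>2 - (T z)\<^sup>2 = (v' z)\<^sup>2 / 4" for z
  proof -
    have "4 * (\<kappa>\<^sup>2 - (T z)\<^sup>2) = 2 * (\<tau> - cos (v z)) / a"
      using T2[of z] by (simp add: \<kappa>2 diff_divide_distrib add_divide_distrib)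
    also have "\<dots> = (v' z)\<^sup>2" using energy[of z] a by (simp add: field_simps)
    finally show ?thesis by simp
  qed
  have cosv: "cos (v z) / a = 2 * (T z)\<^sup>2 - \<kappa>\<^sup>2" for z
    using T2[of z] by (simp add: \<kappa>2 add_divide_distrib)
  have DT: "(T has_real_derivative \<kappa>\<^sup>2 - (T z)\<^sup>2) (at z)" for z
  proof -
    have "(T has_real_derivative (T z)\<^sup>2 - cos (v z) / a) (at z)"
      unfolding T_def using nz[of z] a
      by (auto intro!: derivative_eq_intros D D' simp: field_simps power2_eq_square)
    then show ?thesis by (simp add: cosv)
  qed
  have small: "\<bar>T z / \<kappa>\<bar> < 1" for z
  proof -
    have "(v' z)\<^sup>2 > 0" using nz by simp
    then have "(T z)\<^sup>2 < \<kappa>\<^sup>2" using T'_pos[of z] by linarith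
    then have "\<bar>T z\<bar> < \<kappa>" using \<kappa> by (metis abs_le_square_iff abs_of_pos not_less)
    then show ?thesis using \<kappa> by simp
  qed
  define d where "d = artanh (T 0 / \<kappa>)"
  have "((\<lambda>z. artanh (T z / \<kappa>) - \<kappa> * z) has_real_derivative 0) (at z)" for z
  proof -
    have "(v' z)\<^sup>2 \<noteq> 0" using nz by simp
    then have "\<kappa>\<^sup>2 \<noteq> (T z)\<^sup>2" using T'_pos[of z] by linarith
    then have "1 / (1 - (T z / \<kappa>)\<^sup>2) * ((\<kappa>\<^sup>2 - (T z)\<^sup>2) / \<kappa>) = \<kappa>"
      using \<kappa> by (simp add: field_simps power2_eq_square)
    moreover have "((\<lambda>z. artanh (T z / \<kappa>)) has_real_derivative
        1 / (1 - (T z / \<kappa>)\<^sup>2) * ((\<kappa>\<^sup>2 - (T z)\<^sup>2) / \<kappa>)) (at z)"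
      by (rule DERIV_chain2[OF artanh_real_has_field_derivative[OF small] DERIV_cdivide[OF DT]])
    ultimately show ?thesis by (auto intro!: derivative_eq_intros)
  qed
  then have const: "artanh (T z / \<kappa>) - \<kappa> * z = artanh (T 0 / \<kappa>) - \<kappa> * 0" for z
    using DERIV_isconst_all by blast
  have art: "artanh (T z / \<kappa>) = \<kappa> * z + d" for z
    using const[of z] unfolding d_def by linarith
  have "T z = \<kappa> * tanh (\<kappa> * z + d)" for z
    using tanh_artanh_real[OF small[of z]] \<kappa> by (simp add: art field_simps)
  then show thesis using that[OF \<kappa>, of d] cosv by (simp add: a_def)
qed

section \<open>Explicit solutions of the linearized equation\<close>

text \<open>
  For \<open>T = \<kappa> tanh (\<kappa> z + d)\<close> these are, up to constant factors, the Jost solutions of the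
  one-soliton Poeschl-Teller potential.  They are the images of the exponentials
  \<open>exp (s z)\<close> under the first-order operator \<open>d/dz - T\<close>, which intertwines
  \<open>- d\<^sup>2/dz\<^sup>2 + \<kappa>\<^sup>2\<close> with \<open>- d\<^sup>2/dz\<^sup>2 + 2 T\<^sup>2 - \<kappa>\<^sup>2\<close> whenever \<open>T' = \<kappa>\<^sup>2 - T\<^sup>2\<close>.
\<close>

definition jost :: "(real \<Rightarrow> real) \<Rightarrow> complex \<Rightarrow> real \<Rightarrow> complex" where
  "jost T s z = exp (s * of_real z) * (s - of_real (T z))"

definition jost_deriv :: "real \<Rightarrow> (real \<Rightarrow> real) \<Rightarrow> complex \<Rightarrow> real \<Rightarrow> complex" where
  "jost_deriv \<kappa> T s z =
     exp (s * of_real z) * (s\<^sup>2 - s * of_real (T z) - of_real (\<kappa>\<^sup>2 - (T z)\<^sup>2))"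

lemma exp_linear_has_vector_derivative:
  "((\<lambda>z. exp (s * of_real z)) has_vector_derivative exp (s * of_real z) * s) (at z)"
  for s :: complex
proof -
  have "((\<lambda>x. s * x) has_field_derivative s) (at (of_real z))"
    by (auto intro!: derivative_eq_intros)
  from DERIV_fun_exp[OF this] have "((\<lambda>x. exp (s * x)) has_field_derivative exp (s * of_real z) * s) (at (of_real z))" .
  from has_vector_derivative_real_field[OF this] show ?thesis .
qed

lemma jost_has_vector_derivative:
  assumes T: "\<And>z. (T has_real_derivative \<kappa>\<^sup>2 - (T z)\<^sup>2) (at z)"
  shows "(jost T s has_vector_derivative jost_deriv \<kappa> T s z) (at z)"
proof -
  have T': "((\<lambda>z. complex_of_real (T z)) has_vector_derivative of_real (\<kappa>\<^sup>2 - (T z)\<^sup>2)) (at z)"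
    using T[of z] by (intro has_vector_derivative_of_real) (simp add: has_real_derivative_iff_has_vector_derivative)
  show ?thesis
    unfolding jost_def[abs_def] jost_deriv_def
    by (rule has_vector_derivative_eq_rhs,
        rule has_vector_derivative_mult[OF exp_linear_has_vector_derivative
          has_vector_derivative_diff[OF has_vector_derivative_const T']])
      (simp add: algebra_simps power2_eq_square)
qed

lemma jost_deriv_has_vector_derivative:
  assumes T: "\<And>z. (T has_real_derivative \<kappa>\<^sup>2 - (T z)\<^sup>2) (at z)"
  shows "(jost_deriv \<kappa> T s has_vector_derivative
    (s\<^sup>2 + of_real (2 * (T z)\<^sup>2 - 2 * \<kappa>\<^sup>2)) * jost T s z) (at z)"
proof -
  define R where "R z = (T z)\<^sup>2 - \<kappa>\<^sup>2" for z
  have "(R has_real_derivative 2 * T z * (\<kappa>\<^sup>2 - (T z)\<^sup>2)) (at z)"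
    unfolding R_def[abs_def] by (auto intro!: derivative_eq_intros T)
  then have R': "((\<lambda>z. complex_of_real (R z)) has_vector_derivative
      of_real (2 * T z * (\<kappa>\<^sup>2 - (T z)\<^sup>2))) (at z)"
    by (intro has_vector_derivative_of_real) (simp add: has_real_derivative_iff_has_vector_derivative)
  have T': "((\<lambda>z. complex_of_real (T z)) has_vector_derivative of_real (\<kappa>\<^sup>2 - (T z)\<^sup>2)) (at z)"
    using T[of z] by (intro has_vector_derivative_of_real) (simp add: has_real_derivative_iff_has_vector_derivative)
  have eq: "jost_deriv \<kappa> T s = (\<lambda>z. exp (s * of_real z) * ((s\<^sup>2 - s * of_real (T z)) + of_real (R z)))"
    by (auto simp: jost_deriv_def R_def)
  show ?thesis
    unfolding eq
    by (rule has_vector_derivative_eq_rhs,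
        rule has_vector_derivative_mult[OF exp_linear_has_vector_derivative
          has_vector_derivative_add[OF has_vector_derivative_diff[OF has_vector_derivative_const
            has_vector_derivative_mult[OF has_vector_derivative_const T']] R']])
      (simp add: jost_def R_def algebra_simps power2_eq_square)
qed

text \<open>
  The exponentials cancel and the powers of \<open>T\<close> do as well.  The value vanishes at
  \<open>s = \<kappa>\<close>, where the two solutions become multiples of the translation mode.
\<close>

lemma jost_wronskian:
  "jost T s z * jost_deriv \<kappa> T (- s) z - jost_deriv \<kappa> T s z * jost T (- s) z
     = 2 * s * (s\<^sup>2 - of_real (\<kappa>\<^sup>2))"
proof -
  have e: "exp (s * of_real z) * exp (- s * of_real z) = 1"
    by (simp add: exp_minus)
  have "jost T s z * jost_deriv \<kappa> T (- s) z - jost_deriv \<kappa> T s z * jost T (- s) z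
    = (exp (s * of_real z) * exp (- s * of_real z)) * (2 * s * (s\<^sup>2 - of_real (\<kappa>\<^sup>2)))"
    unfolding jost_def jost_deriv_def of_real_diff of_real_power by algebra
  then show ?thesis unfolding e by simp
qed

lemma wronskian_constant:
  fixes f g f' g' q :: "real \<Rightarrow> complex"
  assumes "\<And>z. (f has_vector_derivative f' z) (at z)"
    and "\<And>z. (f' has_vector_derivative q z * f z) (at z)"
    and "\<And>z. (g has_vector_derivative g' z) (at z)"
    and "\<And>z. (g' has_vector_derivative q z * g z) (at z)"
  obtains K where "\<And>z. f z * g' z - f' z * g z = K"
proof -
  have "((\<lambda>z. f z * g' z - f' z * g z) has_vector_derivative 0) (at z within UNIV)" for z
    by (rule has_vector_derivative_eq_rhs,
        rule has_vector_derivative_diff[OF has_vector_derivative_mult[OF assms(1,4)]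
          has_vector_derivative_mult[OF assms(2,3)]])
      (simp add: algebra_simps)
  from has_vector_derivative_zero_constant[OF convex_UNIV this]
  obtain K where "\<And>z. z \<in> UNIV \<Longrightarrow> f z * g' z - f' z * g z = K" by auto
  then show thesis using that by simp
qed

text \<open>
  Cramer's rule: the Wronskians of \<open>w\<close> with the two explicit solutions are constant, and
  they are the coefficients of \<open>w\<close> up to the factor \<open>W\<close>.  This replaces a uniqueness theorem
  for initial value problems.
\<close>

lemma schroedinger_solution_jost:
  assumes T: "\<And>z. (T has_real_derivative \<kappa>\<^sup>2 - (T z)\<^sup>2) (at z)"
    and s: "s \<noteq> 0" "s\<^sup>2 \<noteq> of_real (\<kappa>\<^sup>2)"
    and w: "\<And>z. (w has_vector_derivative w' z) (at z)"
    and w': "\<And>z. (w' has_vector_derivative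
               (s\<^sup>2 + of_real (2 * (T z)\<^sup>2 - 2 * \<kappa>\<^sup>2)) * w z) (at z)"
  obtains A B where "\<And>z. w z = A * jost T s z + B * jost T (- s) z"
proof -
  let ?f = "jost T s" and ?g = "jost T (- s)"
  let ?f' = "jost_deriv \<kappa> T s" and ?g' = "jost_deriv \<kappa> T (- s)"
  note f = jost_has_vector_derivative[OF T, of s] and g = jost_has_vector_derivative[OF T, of "- s"]
  note f' = jost_deriv_has_vector_derivative[OF T, of s]
  note g' = jost_deriv_has_vector_derivative[OF T, of "- s", unfolded power2_minus]
  define W where "W = 2 * s * (s\<^sup>2 - of_real (\<kappa>\<^sup>2))"
  have W: "W \<noteq> 0" using s by (simp add: W_def)
  obtain A where A: "\<And>z. w z * ?g' z - w' z * ?g z = A"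
    using wronskian_constant[OF w w' g g'] by blast
  obtain B where B: "\<And>z. ?f z * w' z - ?f' z * w z = B"
    using wronskian_constant[OF f f' w w'] by blast
  have "w z = A / W * ?f z + B / W * ?g z" for z
  proof -
    have "w z * W = A * ?f z + B * ?g z"
      unfolding W_def jost_wronskian[of T s z \<kappa>, symmetric] A[of z, symmetric] B[of z, symmetric]
      by algebra
    then show ?thesis using W by (simp add: field_simps)
  qed
  then show thesis by (rule that)
qed

section \<open>Decay at both ends\<close>

lemma norm_exp_mult_of_real: "cmod (exp (\<alpha> * of_real z)) = exp (Re \<alpha> * z)"
  by simp

lemma exp_tendsto_0_at_top:
  fixes \<alpha> :: complex
  assumes "Re \<alpha> < 0"
  shows "((\<lambda>z. exp (\<alpha> * of_real z)) \<longlongrightarrow> 0) at_top"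
proof (rule tendsto_norm_zero_cancel)
  have "filterlim (\<lambda>z. Re \<alpha> * z) at_bot at_top"
    using assms by (intro filterlim_tendsto_neg_mult_at_bot[OF tendsto_const]) (auto simp: filterlim_ident)
  then show "((\<lambda>z. cmod (exp (\<alpha> * of_real z))) \<longlongrightarrow> 0) at_top"
    unfolding norm_exp_mult_of_real by (rule filterlim_compose[OF exp_at_bot])
qed

text \<open>
  Dividing by the dominant exponential, which is bounded below for \<open>z \<ge> 0\<close>, keeps the limit
  \<open>0\<close> and leaves \<open>A f0\<close>.  The case \<open>Re \<alpha> = 0\<close> is included because \<open>f\<close> converges to a nonzero
  limit; it covers \<open>\<mu>\<close> in the essential spectrum.
\<close>

lemma leading_coefficient_zero:
  fixes f g :: "real \<Rightarrow> complex"
  assumes lim: "((\<lambda>z. A * (exp (\<alpha> * of_real z) * f z) + B * (exp (\<beta> * of_real z) * g z)) \<longlongrightarrow> 0) at_top"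
    and f: "(f \<longlongrightarrow> f0) at_top" "f0 \<noteq> 0" and g: "(g \<longlongrightarrow> g0) at_top"
    and re: "0 \<le> Re \<alpha>" "Re \<beta> < Re \<alpha>"
  shows "A = 0"
proof -
  let ?u = "\<lambda>z. A * (exp (\<alpha> * of_real z) * f z) + B * (exp (\<beta> * of_real z) * g z)"
  let ?e = "\<lambda>z::real. exp (- \<alpha> * of_real z)"
  have "((\<lambda>z. ?e z * ?u z) \<longlongrightarrow> 0) at_top"
  proof (rule Lim_null_comparison)
    show "((\<lambda>z. cmod (?u z)) \<longlongrightarrow> 0) at_top" using tendsto_norm_zero[OF lim] .
    show "\<forall>\<^sub>F z in at_top. cmod (?e z * ?u z) \<le> cmod (?u z)"
      using eventually_ge_at_top[of 0]
    proof eventually_elim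
      case (elim z)
      have "cmod (?e z) \<le> 1" using elim re by simp
      then have "cmod (?e z) * cmod (?u z) \<le> 1 * cmod (?u z)" by (intro mult_right_mono) auto
      then show ?case by (simp only: norm_mult mult_1)
    qed
  qed
  moreover have "((\<lambda>z. exp ((\<beta> - \<alpha>) * of_real z) * (B * g z)) \<longlongrightarrow> 0 * (B * g0)) at_top"
    using re by (intro tendsto_intros exp_tendsto_0_at_top g) auto
  ultimately have "((\<lambda>z. ?e z * ?u z - exp ((\<beta> - \<alpha>) * of_real z) * (B * g z)) \<longlongrightarrow> 0 - 0 * (B * g0)) at_top"
    by (rule tendsto_diff)
  moreover have "?e z * ?u z - exp ((\<beta> - \<alpha>) * of_real z) * (B * g z) = A * f z" for z
  proof -
    have "?e z * exp (\<alpha> * of_real z) = 1" by (simp add: exp_minus)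
    moreover have "exp ((\<beta> - \<alpha>) * of_real z) = ?e z * exp (\<beta> * of_real z)"
      by (simp add: exp_add[symmetric] algebra_simps)
    ultimately show ?thesis by algebra
  qed
  ultimately have "((\<lambda>z. A * f z) \<longlongrightarrow> 0) at_top" by simp
  moreover have "((\<lambda>z. A * f z) \<longlongrightarrow> A * f0) at_top" by (intro tendsto_intros f)
  ultimately have "A * f0 = 0" using tendsto_unique trivial_limit_at_top_linorder by blast
  then show ?thesis using f by simp
qed

lemma leading_coefficient_zero_at_bot:
  fixes f g :: "real \<Rightarrow> complex"
  assumes lim: "((\<lambda>z. A * (exp (\<alpha> * of_real z) * f z) + B * (exp (\<beta> * of_real z) * g z)) \<longlongrightarrow> 0) at_bot"
    and f: "(f \<longlongrightarrow> f0) at_bot" "f0 \<noteq> 0" and g: "(g \<longlongrightarrow> g0) at_bot"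
    and re: "Re \<alpha> \<le> 0" "Re \<alpha> < Re \<beta>"
  shows "A = 0"
proof (rule leading_coefficient_zero)
  show "((\<lambda>z. A * (exp (- \<alpha> * of_real z) * f (- z)) + B * (exp (- \<beta> * of_real z) * g (- z))) \<longlongrightarrow> 0) at_top"
    using lim by (simp add: filterlim_at_bot_mirror)
  show "((\<lambda>z. f (- z)) \<longlongrightarrow> f0) at_top" "((\<lambda>z. g (- z)) \<longlongrightarrow> g0) at_top"
    using f g by (simp_all add: filterlim_at_bot_mirror)
qed (use f re in auto)

text \<open>
  Each end detects the exponential that dominates there, unless that exponential decays.
  Since \<open>Re s > 0\<close>, the first one dominates at \<open>\<infinity>\<close> and the second one at \<open>- \<infinity>\<close>; when the
  dominant exponential at one end decays there, the other end sees both of them growing and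
  removes them one after the other.
\<close>

lemma jost_combination_decaying_zero:
  assumes Tbot: "(T \<longlongrightarrow> - \<kappa>) at_bot" and Ttop: "(T \<longlongrightarrow> \<kappa>) at_top"
    and s: "Re s > 0" "s\<^sup>2 \<noteq> of_real (\<kappa>\<^sup>2)"
    and \<phi>: "\<And>z. \<phi> z = exp (- \<rho> * of_real z) * (A * jost T s z + B * jost T (- s) z)"
    and bot: "(\<phi> \<longlongrightarrow> 0) at_bot" and top: "(\<phi> \<longlongrightarrow> 0) at_top"
  shows "\<phi> z = 0"
proof -
  define f where "f z = s - of_real (T z)" for z
  define g where "g z = - s - of_real (T z)" for z
  define \<alpha> where "\<alpha> = s - \<rho>"
  define \<beta> where "\<beta> = - s - \<rho>"
  have less: "Re \<beta> < Re \<alpha>" using s by (simp add: \<alpha>_def \<beta>_def)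
  have \<phi>_eq: "\<phi> = (\<lambda>z. A * (exp (\<alpha> * of_real z) * f z) + B * (exp (\<beta> * of_real z) * g z))"
    by (rule ext) (simp add: \<phi> jost_def f_def g_def \<alpha>_def \<beta>_def algebra_simps exp_add[symmetric] exp_diff exp_minus divide_simps)
  then have \<phi>_eq': "\<phi> = (\<lambda>z. B * (exp (\<beta> * of_real z) * g z) + A * (exp (\<alpha> * of_real z) * f z))"
    by (simp add: add.commute)
  have lim: "(f \<longlongrightarrow> s - of_real \<kappa>) at_top" "(g \<longlongrightarrow> - s - of_real \<kappa>) at_top"
    "(f \<longlongrightarrow> s - of_real (- \<kappa>)) at_bot" "(g \<longlongrightarrow> - s - of_real (- \<kappa>)) at_bot"
    unfolding f_def[abs_def] g_def[abs_def] by (intro tendsto_intros Tbot Ttop)+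
  have "s - of_real \<kappa> \<noteq> 0" "s - of_real (- \<kappa>) \<noteq> 0"
    using s(2) by (auto simp: eq_neg_iff_add_eq_0[symmetric])
  then have nz: "s - of_real \<kappa> \<noteq> 0" "- s - of_real \<kappa> \<noteq> 0"
    "s - of_real (- \<kappa>) \<noteq> 0" "- s - of_real (- \<kappa>) \<noteq> 0"
    by (auto simp: algebra_simps add_eq_0_iff)
  have A_top: "A = 0" if "0 \<le> Re \<alpha>"
    using leading_coefficient_zero[OF top[unfolded \<phi>_eq] lim(1) nz(1) lim(2) that less] .
  have B_bot: "B = 0" if "Re \<beta> \<le> 0"
    using leading_coefficient_zero_at_bot[OF bot[unfolded \<phi>_eq'] lim(4) nz(4) lim(3) that less] .
  \<comment> \<open>With one coefficient gone, the surviving exponential is compared with a strictly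
    smaller one of coefficient \<open>0\<close>, hence the shifts by \<open>1\<close>.\<close>
  have B_top: "B = 0" if "A = 0" "0 \<le> Re \<beta>"
    by (rule leading_coefficient_zero[OF _ lim(2) nz(2) tendsto_const, where \<alpha> = \<beta> and B = 0 and \<beta> = "\<beta> - 1"])
      (use top that in \<open>auto simp: \<phi>_eq\<close>)
  have A_bot: "A = 0" if "B = 0" "Re \<alpha> \<le> 0"
    by (rule leading_coefficient_zero_at_bot[OF _ lim(3) nz(3) tendsto_const, where \<alpha> = \<alpha> and B = 0 and \<beta> = "\<alpha> + 1"])
      (use bot that in \<open>auto simp: \<phi>_eq\<close>)
  have "A = 0 \<and> B = 0"
    using A_top B_bot A_bot B_top less by linarith
  then show ?thesis by (simp add: \<phi>)
qed

section \<open>Spectral stability\<close>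

lemma liouville_transform:
  fixes \<phi> \<phi>' \<phi>'' :: "real \<Rightarrow> complex"
  assumes "\<And>z. (\<phi> has_vector_derivative \<phi>' z) (at z)"
    and "\<And>z. (\<phi>' has_vector_derivative \<phi>'' z) (at z)"
  shows "((\<lambda>z. exp (\<rho> * of_real z) * \<phi> z) has_vector_derivative
            exp (\<rho> * of_real z) * (\<phi>' z + \<rho> * \<phi> z)) (at z)"
    and "((\<lambda>z. exp (\<rho> * of_real z) * (\<phi>' z + \<rho> * \<phi> z)) has_vector_derivative
            exp (\<rho> * of_real z) * (\<phi>'' z + 2 * \<rho> * \<phi>' z + \<rho>\<^sup>2 * \<phi> z)) (at z)"
proof -
  show "((\<lambda>z. exp (\<rho> * of_real z) * \<phi> z) has_vector_derivative
            exp (\<rho> * of_real z) * (\<phi>' z + \<rho> * \<phi> z)) (at z)"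
    by (rule has_vector_derivative_eq_rhs,
        rule has_vector_derivative_mult[OF exp_linear_has_vector_derivative assms(1)])
      (simp add: algebra_simps)
  show "((\<lambda>z. exp (\<rho> * of_real z) * (\<phi>' z + \<rho> * \<phi> z)) has_vector_derivative
            exp (\<rho> * of_real z) * (\<phi>'' z + 2 * \<rho> * \<phi>' z + \<rho>\<^sup>2 * \<phi> z)) (at z)"
    by (rule has_vector_derivative_eq_rhs,
        rule has_vector_derivative_mult[OF exp_linear_has_vector_derivative
          has_vector_derivative_add[OF assms(2)
            has_vector_derivative_mult[OF has_vector_derivative_const assms(1)]]])
      (simp add: algebra_simps power2_eq_square)
qed

text \<open>
  The principal root lies in the open right half plane except over the nonpositive reals,
  where \<open>\<mu>\<^sup>2 \<le> - r < 0\<close> would make \<open>\<mu>\<close> purely imaginary.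
\<close>

lemma Re_csqrt_pos:
  fixes \<mu> :: complex
  assumes "Re \<mu> > 0" "r > 0"
  shows "Re (csqrt (\<mu>\<^sup>2 + of_real r)) > 0"
proof (rule ccontr)
  let ?s = "csqrt (\<mu>\<^sup>2 + of_real r)"
  assume "\<not> 0 < Re ?s"
  then have "Re ?s = 0" using csqrt_principal[of "\<mu>\<^sup>2 + of_real r"] by auto
  then have "Re (?s\<^sup>2) \<le> 0" "Im (?s\<^sup>2) = 0"
    unfolding Re_power2 Im_power2 by simp_all
  then have "(Re \<mu>)\<^sup>2 - (Im \<mu>)\<^sup>2 + r \<le> 0" "Re \<mu> * Im \<mu> = 0"
    unfolding power2_csqrt by (auto simp: Re_power2 Im_power2)
  then have "(Re \<mu>)\<^sup>2 + r \<le> 0" using assms by auto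
  then show False using assms by (smt (verit) zero_le_power2)
qed

theorem theorem1:
  fixes c :: real and v :: "real \<Rightarrow> real"
  assumes "c > 0" and "c\<^sup>2 \<noteq> 1" and "kink_wave c v"
  shows "spectrally_stable c v"
  unfolding spectrally_stable_def
proof (intro notI, elim exE conjE)
  fix \<mu>
  assume "eigenvalue c v \<mu>" and Re_\<mu>: "Re \<mu> > 0"
  then obtain \<phi> \<phi>' \<phi>'' :: "real \<Rightarrow> complex" where
    D: "\<And>z. (\<phi> has_vector_derivative \<phi>' z) (at z)"
    and D': "\<And>z. (\<phi>' has_vector_derivative \<phi>'' z) (at z)"
    and ex: "\<exists>z. \<phi> z \<noteq> 0"
    and eq: "\<And>z. of_real (c\<^sup>2 - 1) * \<phi>'' z + 2 * of_real c * \<mu> * \<phi>' z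
               + (\<mu>\<^sup>2 - of_real (cos (v z))) * \<phi> z = 0"
    and bot: "(\<phi> \<longlongrightarrow> 0) at_bot" and top: "(\<phi> \<longlongrightarrow> 0) at_top"
    unfolding eigenvalue_def by blast
  obtain \<kappa> d where \<kappa>: "\<kappa> > 0"
    and pot: "\<And>z. cos (v z) / (c\<^sup>2 - 1) = 2 * (\<kappa> * tanh (\<kappa> * z + d))\<^sup>2 - \<kappa>\<^sup>2"
    using kink_potential_tanh[OF assms(2,3)] by blast
  define T where "T z = \<kappa> * tanh (\<kappa> * z + d)" for z
  have T: "(T has_real_derivative \<kappa>\<^sup>2 - (T z)\<^sup>2) (at z)" for z
  proof -
    have "cosh (\<kappa> * z + d) \<noteq> 0" by simp
    then show ?thesis unfolding T_def
      by (auto intro!: derivative_eq_intros simp: algebra_simps power2_eq_square)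
  qed
  have lin: "filterlim (\<lambda>z. \<kappa> * z + d) at_top at_top" "filterlim (\<lambda>z. \<kappa> * z + d) at_bot at_bot"
    using \<kappa> by real_asymp+
  have Ttop: "(T \<longlongrightarrow> \<kappa>) at_top"
    using tendsto_mult[OF tendsto_const filterlim_compose[OF tanh_real_at_top lin(1)], of \<kappa>]
    by (simp add: T_def[abs_def])
  have Tbot: "(T \<longlongrightarrow> - \<kappa>) at_bot"
    using tendsto_mult[OF tendsto_const filterlim_compose[OF tanh_real_at_bot lin(2)], of \<kappa>]
    by (simp add: T_def[abs_def])
  define a where "a = c\<^sup>2 - 1"
  have "a \<noteq> 0" using assms(2) by (simp add: a_def)
  then have a: "a \<noteq> 0" "complex_of_real a \<noteq> 0" by auto
  \<comment> \<open>The absolute value keeps \<open>Re \<nu> > 0\<close> when \<open>c < 1\<close>; only \<open>\<nu>\<^sup>2\<close> enters the equation.\<close>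
  define \<nu> where "\<nu> = \<mu> / of_real \<bar>a\<bar>"
  define s where "s = csqrt (\<nu>\<^sup>2 + of_real (\<kappa>\<^sup>2))"
  have "Re \<nu> > 0" using Re_\<mu> a by (simp add: \<nu>_def)
  then have "\<nu> \<noteq> 0" by auto
  have s2: "s\<^sup>2 = \<nu>\<^sup>2 + of_real (\<kappa>\<^sup>2)" by (simp add: s_def)
  then have s2': "s\<^sup>2 \<noteq> of_real (\<kappa>\<^sup>2)" using \<open>\<nu> \<noteq> 0\<close> by simp
  have Re_s: "Re s > 0" unfolding s_def using Re_csqrt_pos[OF \<open>Re \<nu> > 0\<close>, of "\<kappa>\<^sup>2"] \<kappa> by simp
  then have "s \<noteq> 0" by auto
  define \<rho> where "\<rho> = of_real c * \<mu> / of_real a"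
  let ?w = "\<lambda>z. exp (\<rho> * of_real z) * \<phi> z"
  have reduced: "exp (\<rho> * of_real z) * (\<phi>'' z + 2 * \<rho> * \<phi>' z + \<rho>\<^sup>2 * \<phi> z)
      = (s\<^sup>2 + of_real (2 * (T z)\<^sup>2 - 2 * \<kappa>\<^sup>2)) * ?w z" for z
  proof -
    have cv: "of_real (cos (v z)) = of_real a * (of_real (2 * (T z)\<^sup>2 - \<kappa>\<^sup>2) :: complex)"
      unfolding of_real_mult[symmetric] T_def pot[of z, symmetric] a_def[symmetric] using a by simp
    have \<mu>: "\<mu>\<^sup>2 = of_real a ^ 2 * \<nu>\<^sup>2"
      using a by (simp add: \<nu>_def power_divide flip: of_real_power)
    have \<rho>: "of_real c * \<mu> = of_real a * \<rho>" using a by (simp add: \<rho>_def)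
    \<comment> \<open>Here \<open>c\<^sup>2 = a + 1\<close> makes \<open>\<rho>\<^sup>2 - \<mu>\<^sup>2 / a\<close> collapse to \<open>\<nu>\<^sup>2\<close>.\<close>
    have c2: "(of_real c)\<^sup>2 = complex_of_real a + 1" by (simp add: a_def)
    have "of_real a ^ 2 * \<rho>\<^sup>2 = (of_real a + 1) * (of_real a ^ 2 * \<nu>\<^sup>2)"
      using \<rho> \<mu> c2 by (metis power_mult_distrib)
    then have \<rho>2: "\<rho>\<^sup>2 = (of_real a + 1) * \<nu>\<^sup>2" using a by simp
    have "of_real a * \<phi>'' z + 2 * (of_real a * \<rho>) * \<phi>' z
        + (of_real a ^ 2 * \<nu>\<^sup>2 - of_real a * of_real (2 * (T z)\<^sup>2 - \<kappa>\<^sup>2)) * \<phi> z = 0"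
      using eq[of z] unfolding cv \<mu> a_def[symmetric] \<rho>[symmetric] by (simp add: mult.assoc)
    then have "of_real a * (\<phi>'' z + 2 * \<rho> * \<phi>' z
        + (of_real a * \<nu>\<^sup>2 - of_real (2 * (T z)\<^sup>2 - \<kappa>\<^sup>2)) * \<phi> z) = 0"
      by (simp add: algebra_simps power2_eq_square)
    then have "\<phi>'' z + 2 * \<rho> * \<phi>' z
        + (of_real a * \<nu>\<^sup>2 - of_real (2 * (T z)\<^sup>2 - \<kappa>\<^sup>2)) * \<phi> z = 0" using a by simp
    then show ?thesis unfolding s2 \<rho>2 of_real_diff of_real_mult of_real_numeral by algebra
  qed
  have "\<And>z. ((\<lambda>z. exp (\<rho> * of_real z) * (\<phi>' z + \<rho> * \<phi> z)) has_vector_derivative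
            (s\<^sup>2 + of_real (2 * (T z)\<^sup>2 - 2 * \<kappa>\<^sup>2)) * ?w z) (at z)"
    using liouville_transform(2)[OF D D', of \<rho>] unfolding reduced .
  then obtain A B where AB: "\<And>z. ?w z = A * jost T s z + B * jost T (- s) z"
    using schroedinger_solution_jost[OF T \<open>s \<noteq> 0\<close> s2' liouville_transform(1)[OF D D']] by blast
  have "\<phi> z = exp (- \<rho> * of_real z) * (A * jost T s z + B * jost T (- s) z)" for z
    unfolding AB[symmetric] by (simp add: exp_minus)
  then have "\<phi> z = 0" for z
    by (rule jost_combination_decaying_zero[OF Tbot Ttop Re_s s2' _ bot top])
  then show False using ex by blast
qed

end
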